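(* Let $(X,d)$ be a complete metric space, $m\ge2$, and let $\mathcal S=(X,(\phi_j)_{j=1}^L,(\rho_j)_{j=1}^L)$ be a GIFZS of degree $m$ on $X$ consisting of generalized Banach contractions, with fuzzy attractor $u_{\mathcal S}$. Let $\varepsilon>0$, let $\hat X$ be a proper $\varepsilon$-net of $X$, let $r:X\to\hat X$ be an $\varepsilon$-projection, and let $\hat{\mathcal S}=(\hat X,(\hat\phi_j)_{j=1}^L,(\rho_j)_{j=1}^L)$, where $\hat\phi_j:=(r\circ\phi_j)_{|\hat X^m}:\hat X^m\to\hat X$ for $j=1,\dots,L$. Then for any $u\in\mathcal F^*_{\hat X}$ and every $n\in\mathbb N$, $$d_\infty\big(e(\overline Z_{\hat{\mathcal S}}^{\,n}(u)),u_{\mathcal S}\big)\le\frac{5\varepsilon}{1-\alpha_{\mathcal S}}+\alpha_{\mathcal S}^{\,n}\,d_\infty(e(u),u_{\mathcal S}).$$ In particular, there is $n_0\in\mathbb N$ such that for every $n\ge n_0$, $e(\overline Z_{\hat{\mathcal S}}^{\,n}(u))$ is an attractor of $\mathcal S$ with resolution $\frac{6\varepsilon}{1-\alpha_{\mathcal S}}$.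
   Context: Fuzzy sets: a fuzzy subset of a set $X$ is a function $u:X\to[0,1]$; $\mathcal F_X$ is the family of all of them. For a metric space $X$, the $\alpha$-cut is $[u]^\alpha=\{x:u(x)\ge\alpha\}$ for $\alpha\in(0,1]$ and $[u]^0=\operatorname{cl}\{x:u(x)>0\}$. $\mathcal F_X^*$ is the set of $u\in\mathcal F_X$ that are normal ($u(x)=1$ for some $x$), upper semicontinuous ($[u]^\alpha$ closed for all $\alpha>0$) and compactly supported ($[u]^0$ compact). With $h$ the Hausdorff metric on nonempty compact sets, $d_\infty(u,v):=\sup_{\alpha\in[0,1]}h([u]^\alpha,[v]^\alpha)$ is a metric on $\mathcal F_X^*$. For $\phi:X\to Y$ and $u\in\mathcal F_X$, $\phi(u)\in\mathcal F_Y$ is $\phi(u)(y)=\sup\{u(x):x\in\phi^{-1}(y)\}$, with $\sup\emptyset=0$. For $u_0,\dots,u_{m-1}\in\mathcal F_X$, the product $u_0\times\dots\times u_{m-1}\in\mathcal F_{X^m}$ is $(x_0,\dots,x_{m-1})\mapsto\min_i u_i(x_i)$. GIFZS: $X^m$ carries the maximum metric $d_m((x_i),(y_i))=\max_i d(x_i,y_i)$; a generalized Banach contraction is a map $f:X^m\to X$ with $\operatorname{Lip}(f)<1$. A generalized iterated fuzzy function system (GIFZS) of degree $m$, $\mathcal S=(X,(\phi_j)_{j=1}^L,(\rho_j)_{j=1}^L)$, consists of finitely many continuous maps $\phi_j:X^m\to X$ and an admissible system of grey level maps $\rho_j:[0,1]\to[0,1]$, i.e. each $\rho_j$ is nondecreasing,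 right continuous with $\rho_j(0)=0$, and $\rho_j(1)=1$ for some $j$. Its operator $Z_{\mathcal S}:(\mathcal F_X^* )^m\to\mathcal F_X^*$ is $Z_{\mathcal S}(u_0,\dots,u_{m-1})=\max_{1\le j\le L}\rho_j(\phi_j(u_0\times\dots\times u_{m-1}))$ (pointwise maximum), and $\overline Z_{\mathcal S}:\mathcal F_X^*\to\mathcal F_X^*$ is $\overline Z_{\mathcal S}(u)=Z_{\mathcal S}(u,\dots,u)$. $\alpha_{\mathcal S}:=\max_j\operatorname{Lip}(\phi_j)$. The fuzzy attractor (generalized fuzzy fractal) is the $u_{\mathcal S}\in\mathcal F_X^*$ with $Z_{\mathcal S}(u_{\mathcal S},\dots,u_{\mathcal S})=u_{\mathcal S}$; it exists and is unique when $X$ is (nonempty and) complete and the $\phi_j$ are generalized Banach contractions. For $\delta>0$, $u_\delta\in\mathcal F_X^*$ is an attractor of $\mathcal S$ with resolution $\delta$ if $d_\infty(u_\delta,u_{\mathcal S})\le\delta$. Nets: $\hat X\subset X$ is an $\varepsilon$-net of $X$ if for every $x\in X$ there is $y\in\hat X$ with $d(x,y)\le\varepsilon$; it is proper if $D\cap\hat X$ is finite for every bounded $D\subset X$. An $\varepsilon$-projection is a map $r:X\to\hat X$ with $r(x)=x$ for $x\in\hat X$ and $d(x,r(x))\le\varepsilon$ for all $x\in X$. For $u:\hat X\to[0,1]$, $e(u):X\to[0,1]$ is the extension of $u$ by $0$ on $X\setminus\hat X$. *)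

theory Defs
  imports "HOL-Analysis.Analysis"
begin

text \<open>
  Metric spaces are subsets \<open>X\<close> of a type of class \<open>metric_space\<close>, so that the same definitions
  apply to a space and to its subspaces. Functions with domain \<open>X\<close> are extensional:
  a fuzzy subset of \<open>X\<close> is an element of \<open>X \<rightarrow>\<^sub>E {0..1}\<close>, and \<open>X\<^sup>m\<close> is \<open>{..<m} \<rightarrow>\<^sub>E X\<close>.
\<close>

subsection \<open>Fuzzy sets\<close>

definition fuzzy_sets :: "'a set \<Rightarrow> ('a \<Rightarrow> real) set" where
  "fuzzy_sets X = X \<rightarrow>\<^sub>E {0..1}"

text \<open>The closure in the \<open>0\<close>-cut is the closure relative to \<open>X\<close>.\<close>

definition alpha_cut :: "'a::metric_space set \<Rightarrow> ('a \<Rightarrow> real) \<Rightarrow> real \<Rightarrow> 'a set" where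
  "alpha_cut X u \<alpha> =
     (if \<alpha> = 0 then X \<inter> closure {x \<in> X. u x > 0} else {x \<in> X. u x \<ge> \<alpha>})"

definition fuzzy_star :: "'a::metric_space set \<Rightarrow> ('a \<Rightarrow> real) set" where
  "fuzzy_star X = {u \<in> fuzzy_sets X.
     (\<exists>x\<in>X. u x = 1) \<and>
     (\<forall>\<alpha>\<in>{0<..1}. closedin (top_of_set X) (alpha_cut X u \<alpha>)) \<and>
     compact (alpha_cut X u 0)}"

definition hausdorff_dist :: "'a::metric_space set \<Rightarrow> 'a set \<Rightarrow> real" where
  "hausdorff_dist A B = max (SUP a\<in>A. infdist a B) (SUP b\<in>B. infdist b A)"

text \<open>The supremum is a supremum of a bounded set of reals for \<open>u, v \<in> fuzzy_star X\<close>.\<close>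

definition d_infty :: "'a::metric_space set \<Rightarrow> ('a \<Rightarrow> real) \<Rightarrow> ('a \<Rightarrow> real) \<Rightarrow> real" where
  "d_infty X u v = (SUP \<alpha>\<in>{0..1}. hausdorff_dist (alpha_cut X u \<alpha>) (alpha_cut X v \<alpha>))"

definition fuzzy_image ::
  "'b set \<Rightarrow> 'a set \<Rightarrow> ('b \<Rightarrow> 'a) \<Rightarrow> ('b \<Rightarrow> real) \<Rightarrow> 'a \<Rightarrow> real" where
  "fuzzy_image D Y \<phi> u =
     (\<lambda>y\<in>Y. if {x \<in> D. \<phi> x = y} = {} then 0 else (SUP x\<in>{x \<in> D. \<phi> x = y}. u x))"

definition tuples :: "'a set \<Rightarrow> nat \<Rightarrow> (nat \<Rightarrow> 'a) set" where
  "tuples X m = {..<m} \<rightarrow>\<^sub>E X"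

definition fuzzy_prod ::
  "'a set \<Rightarrow> nat \<Rightarrow> (nat \<Rightarrow> 'a \<Rightarrow> real) \<Rightarrow> (nat \<Rightarrow> 'a) \<Rightarrow> real" where
  "fuzzy_prod X m us = (\<lambda>x\<in>tuples X m. Min ((\<lambda>i. us i (x i)) ` {..<m}))"

definition fuzzy_ext :: "'a set \<Rightarrow> 'a set \<Rightarrow> ('a \<Rightarrow> real) \<Rightarrow> 'a \<Rightarrow> real" where
  "fuzzy_ext X Xh u = (\<lambda>x\<in>X. if x \<in> Xh then u x else 0)"

subsection \<open>Generalized iterated fuzzy function systems\<close>

definition max_dist :: "nat \<Rightarrow> (nat \<Rightarrow> 'a::metric_space) \<Rightarrow> (nat \<Rightarrow> 'a) \<Rightarrow> real" where
  "max_dist m x y = Max ((\<lambda>i. dist (x i) (y i)) ` {..<m})"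

definition lip_bound ::
  "'a::metric_space set \<Rightarrow> nat \<Rightarrow> ((nat \<Rightarrow> 'a) \<Rightarrow> 'a) \<Rightarrow> real \<Rightarrow> bool" where
  "lip_bound X m f c \<longleftrightarrow> 0 \<le> c \<and>
     (\<forall>x\<in>tuples X m. \<forall>y\<in>tuples X m. dist (f x) (f y) \<le> c * max_dist m x y)"

definition Lip :: "'a::metric_space set \<Rightarrow> nat \<Rightarrow> ((nat \<Rightarrow> 'a) \<Rightarrow> 'a) \<Rightarrow> real" where
  "Lip X m f = Inf {c. lip_bound X m f c}"

text \<open>
  As \<open>Lip\<close> is real valued, \<open>Lip X m f < 1\<close> is meaningful only for Lipschitz \<open>f\<close>.
\<close>

definition gen_banach_contraction ::
  "'a::metric_space set \<Rightarrow> nat \<Rightarrow> ((nat \<Rightarrow> 'a) \<Rightarrow> 'a) \<Rightarrow> bool" where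
  "gen_banach_contraction X m f \<longleftrightarrow>
     f \<in> tuples X m \<rightarrow> X \<and> (\<exists>c. lip_bound X m f c) \<and> Lip X m f < 1"

definition grey_level_map :: "(real \<Rightarrow> real) \<Rightarrow> bool" where
  "grey_level_map \<rho> \<longleftrightarrow> \<rho> \<in> {0..1} \<rightarrow> {0..1} \<and> mono_on {0..1} \<rho> \<and>
     (\<forall>t\<in>{0..1}. continuous (at t within {t..1}) \<rho>) \<and> \<rho> 0 = 0"

definition admissible :: "nat \<Rightarrow> (nat \<Rightarrow> real \<Rightarrow> real) \<Rightarrow> bool" where
  "admissible L \<rho> \<longleftrightarrow> (\<forall>j\<in>{1..L}. grey_level_map (\<rho> j)) \<and> (\<exists>j\<in>{1..L}. \<rho> j 1 = 1)"

text \<open>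
  Continuity refers to the product topology of \<open>nat \<Rightarrow> 'a\<close>; on \<open>tuples X m\<close> this is the
  topology of \<open>max_dist m\<close>.
\<close>

definition gifzs ::
  "'a::metric_space set \<Rightarrow> nat \<Rightarrow> nat \<Rightarrow> (nat \<Rightarrow> (nat \<Rightarrow> 'a) \<Rightarrow> 'a) \<Rightarrow> (nat \<Rightarrow> real \<Rightarrow> real) \<Rightarrow> bool"
  where
  "gifzs X m L \<phi> \<rho> \<longleftrightarrow>
     (\<forall>j\<in>{1..L}. \<phi> j \<in> tuples X m \<rightarrow> X \<and> continuous_on (tuples X m) (\<phi> j)) \<and> admissible L \<rho>"

definition Z_op ::
  "'a set \<Rightarrow> nat \<Rightarrow> nat \<Rightarrow> (nat \<Rightarrow> (nat \<Rightarrow> 'a) \<Rightarrow> 'a) \<Rightarrow> (nat \<Rightarrow> real \<Rightarrow> real)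
     \<Rightarrow> (nat \<Rightarrow> 'a \<Rightarrow> real) \<Rightarrow> 'a \<Rightarrow> real" where
  "Z_op X m L \<phi> \<rho> us =
     (\<lambda>x\<in>X. Max ((\<lambda>j. \<rho> j (fuzzy_image (tuples X m) X (\<phi> j) (fuzzy_prod X m us) x)) ` {1..L}))"

definition Z_bar ::
  "'a set \<Rightarrow> nat \<Rightarrow> nat \<Rightarrow> (nat \<Rightarrow> (nat \<Rightarrow> 'a) \<Rightarrow> 'a) \<Rightarrow> (nat \<Rightarrow> real \<Rightarrow> real)
     \<Rightarrow> ('a \<Rightarrow> real) \<Rightarrow> 'a \<Rightarrow> real" where
  "Z_bar X m L \<phi> \<rho> u = Z_op X m L \<phi> \<rho> (\<lambda>_. u)"

definition alpha_S ::
  "'a::metric_space set \<Rightarrow> nat \<Rightarrow> nat \<Rightarrow> (nat \<Rightarrow> (nat \<Rightarrow> 'a) \<Rightarrow> 'a) \<Rightarrow> real" where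
  "alpha_S X m L \<phi> = Max ((\<lambda>j. Lip X m (\<phi> j)) ` {1..L})"

definition fuzzy_attractor ::
  "'a::metric_space set \<Rightarrow> nat \<Rightarrow> nat \<Rightarrow> (nat \<Rightarrow> (nat \<Rightarrow> 'a) \<Rightarrow> 'a) \<Rightarrow> (nat \<Rightarrow> real \<Rightarrow> real)
     \<Rightarrow> ('a \<Rightarrow> real) \<Rightarrow> bool" where
  "fuzzy_attractor X m L \<phi> \<rho> uS \<longleftrightarrow>
     uS \<in> fuzzy_star X \<and> Z_op X m L \<phi> \<rho> (\<lambda>_. uS) = uS"

definition attractor_with_resolution ::
  "'a::metric_space set \<Rightarrow> nat \<Rightarrow> nat \<Rightarrow> (nat \<Rightarrow> (nat \<Rightarrow> 'a) \<Rightarrow> 'a) \<Rightarrow> (nat \<Rightarrow> real \<Rightarrow> real)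
     \<Rightarrow> real \<Rightarrow> ('a \<Rightarrow> real) \<Rightarrow> bool" where
  "attractor_with_resolution X m L \<phi> \<rho> \<delta> v \<longleftrightarrow> v \<in> fuzzy_star X \<and>
     (\<exists>uS. fuzzy_attractor X m L \<phi> \<rho> uS \<and> d_infty X v uS \<le> \<delta>)"

subsection \<open>Nets and projections\<close>

definition eps_net :: "'a::metric_space set \<Rightarrow> real \<Rightarrow> 'a set \<Rightarrow> bool" where
  "eps_net X \<epsilon> Xh \<longleftrightarrow> Xh \<subseteq> X \<and> (\<forall>x\<in>X. \<exists>y\<in>Xh. dist x y \<le> \<epsilon>)"

definition proper_eps_net :: "'a::metric_space set \<Rightarrow> real \<Rightarrow> 'a set \<Rightarrow> bool" where
  "proper_eps_net X \<epsilon> Xh \<longleftrightarrow> eps_net X \<epsilon> Xh \<and> (\<forall>D\<subseteq>X. bounded D \<longrightarrow> finite (D \<inter> Xh))"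

definition eps_projection ::
  "'a::metric_space set \<Rightarrow> real \<Rightarrow> 'a set \<Rightarrow> ('a \<Rightarrow> 'a) \<Rightarrow> bool" where
  "eps_projection X \<epsilon> Xh r \<longleftrightarrow>
     r \<in> X \<rightarrow> Xh \<and> (\<forall>x\<in>Xh. r x = x) \<and> (\<forall>x\<in>X. dist x (r x) \<le> \<epsilon>)"

definition discretization ::
  "'a set \<Rightarrow> nat \<Rightarrow> ('a \<Rightarrow> 'a) \<Rightarrow> (nat \<Rightarrow> (nat \<Rightarrow> 'a) \<Rightarrow> 'a) \<Rightarrow> nat \<Rightarrow> (nat \<Rightarrow> 'a) \<Rightarrow> 'a" where
  "discretization Xh m r \<phi> j = restrict (r \<circ> \<phi> j) (tuples Xh m)"

end

theory Submission
  imports Defs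
begin

text \<open>
  For fuzzy sets \<open>u\<close>, \<open>v\<close> in \<open>fuzzy_star X\<close>, \<open>d_infty X u v \<le> D\<close> means that every point \<open>x\<close> with
  \<open>u x > 0\<close> is \<open>D\<close>-close to a point \<open>y\<close> with \<open>v y \<ge> u x\<close>, and conversely. Suprema over
  fibres are attained (by finiteness over the net, by compactness for the attractor), so a point of
  positive grade under one operator comes from a tuple; moving its entries by at most \<open>D\<close> and
  applying the other operator moves the image by at most \<open>\<epsilon> + \<alpha> * D\<close>, the \<open>\<epsilon>\<close> being due to the
  projection. Comparing the discretized orbit with the attractor itself (rather than with the orbit
  of the extension) and summing the geometric series even gives \<open>\<epsilon> / (1 - \<alpha>)\<close> as error term.
\<close>

subsection \<open>Images and grey level maps\<close>

lemma fuzzy_setsD: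
  assumes "u \<in> fuzzy_sets X" "x \<in> X"
  shows "0 \<le> u x" "u x \<le> 1"
  using assms by (auto simp: fuzzy_sets_def PiE_def Pi_def)

lemma fuzzy_starD:
  assumes "u \<in> fuzzy_star X"
  shows "u \<in> fuzzy_sets X" "\<exists>x\<in>X. u x = 1" "compact (alpha_cut X u 0)"
    and "0 < c \<Longrightarrow> c \<le> 1 \<Longrightarrow> closedin (top_of_set X) (alpha_cut X u c)"
  using assms by (auto simp: fuzzy_star_def)

lemma tuplesD: "z \<in> tuples X m \<Longrightarrow> i < m \<Longrightarrow> z i \<in> X"
  by (auto simp: tuples_def)

lemma le_fuzzy_prod_iff:
  assumes "z \<in> tuples X m" "m > 0"
  shows "c \<le> fuzzy_prod X m us z \<longleftrightarrow> (\<forall>i<m. c \<le> us i (z i))"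
proof -
  have "(\<lambda>i. us i (z i)) ` {..<m} \<noteq> {}"
    using assms(2) by auto
  then show ?thesis
    using assms(1) by (auto simp: fuzzy_prod_def Min_ge_iff)
qed

lemma fuzzy_prod_mem:
  assumes "z \<in> tuples X m" "m > 0"
  shows "\<exists>i<m. fuzzy_prod X m us z = us i (z i)"
proof -
  have "Min ((\<lambda>i. us i (z i)) ` {..<m}) \<in> (\<lambda>i. us i (z i)) ` {..<m}"
    using assms(2) by (intro Min_in) auto
  then show ?thesis
    using assms(1) by (auto simp: fuzzy_prod_def)
qed

lemma fuzzy_prod_bounds:
  assumes "z \<in> tuples X m" "m > 0" "u \<in> fuzzy_sets X"
  shows "0 \<le> fuzzy_prod X m (\<lambda>_. u) z" "fuzzy_prod X m (\<lambda>_. u) z \<le> 1"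
  using fuzzy_prod_mem[OF assms(1,2), of "\<lambda>_. u"] fuzzy_setsD[OF assms(3)] tuplesD[OF assms(1)]
  by auto

lemma fuzzy_image_upper:
  assumes "z \<in> D" "\<phi> z \<in> Y" "\<And>z. z \<in> D \<Longrightarrow> p z \<le> (1::real)"
  shows "p z \<le> fuzzy_image D Y \<phi> p (\<phi> z)"
proof -
  have "p z \<le> (SUP x\<in>{x \<in> D. \<phi> x = \<phi> z}. p x)"
    using assms(1,3) by (intro cSUP_upper bdd_aboveI2[of _ _ 1]) auto
  then show ?thesis
    using assms(1,2) by (auto simp: fuzzy_image_def)
qed

lemma fuzzy_image_bounds:
  assumes "y \<in> Y" "\<And>z. z \<in> D \<Longrightarrow> 0 \<le> p z" "\<And>z. z \<in> D \<Longrightarrow> p z \<le> 1"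
  shows "fuzzy_image D Y \<phi> p y \<in> {0..1}"
proof (cases "{x \<in> D. \<phi> x = y} = {}")
  case True
  then show ?thesis
    using assms(1) by (simp add: fuzzy_image_def)
next
  case False
  then obtain z where z: "z \<in> D" "\<phi> z = y"
    by auto
  have "p z \<le> fuzzy_image D Y \<phi> p y"
    using fuzzy_image_upper[of z D \<phi> Y p] z assms by auto
  moreover have "(SUP x\<in>{x \<in> D. \<phi> x = y}. p x) \<le> 1"
    using False assms(3) by (intro cSUP_least) auto
  moreover have "fuzzy_image D Y \<phi> p y = (SUP x\<in>{x \<in> D. \<phi> x = y}. p x)"
    using False assms(1) by (auto simp: fuzzy_image_def)
  ultimately show ?thesis
    using assms(2)[OF z(1)] by simp
qed

text \<open>Only positive grades are required, since an empty fibre receives the default grade 0 and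
  has no witness. For \<open>p\<close> bounded by 1 the inequality is an equality, by
  \<open>fuzzy_image_upper\<close>.\<close>

definition fuzzy_image_attained ::
  "'b set \<Rightarrow> 'a set \<Rightarrow> ('b \<Rightarrow> 'a) \<Rightarrow> ('b \<Rightarrow> real) \<Rightarrow> bool" where
  "fuzzy_image_attained D Y \<phi> p \<longleftrightarrow>
     (\<forall>y\<in>Y. fuzzy_image D Y \<phi> p y > 0 \<longrightarrow> (\<exists>z\<in>D. \<phi> z = y \<and> fuzzy_image D Y \<phi> p y \<le> p z))"

text \<open>A finite range of \<open>p\<close> turns the supremum over each nonempty fibre into a
  maximum; the fibre itself may be infinite.\<close>

lemma fuzzy_image_attained_finite:
  assumes "finite (p ` D)"
  shows "fuzzy_image_attained D Y \<phi> p"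
  unfolding fuzzy_image_attained_def
proof (intro ballI impI)
  fix y assume y: "y \<in> Y" "fuzzy_image D Y \<phi> p y > 0"
  let ?F = "{x \<in> D. \<phi> x = y}"
  from y have ne: "?F \<noteq> {}"
    by (auto simp: fuzzy_image_def split: if_splits)
  have fin: "finite (p ` ?F)"
    using assms by (rule finite_subset[rotated]) auto
  have "Sup (p ` ?F) = Max (p ` ?F)"
    using fin ne by (intro cSup_eq_Max) auto
  then have "Sup (p ` ?F) \<in> p ` ?F"
    using Max_in[OF fin] ne by simp
  moreover have "fuzzy_image D Y \<phi> p y = Sup (p ` ?F)"
    using ne y(1) by (auto simp: fuzzy_image_def)
  ultimately show "\<exists>z\<in>D. \<phi> z = y \<and> fuzzy_image D Y \<phi> p y \<le> p z"
    by auto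
qed

lemma finite_fuzzy_prod_range:
  assumes "finite (u ` X)" "m > 0"
  shows "finite (fuzzy_prod X m (\<lambda>_. u) ` tuples X m)"
proof (rule finite_subset[OF _ assms(1)], safe)
  fix z assume "z \<in> tuples X m"
  then show "fuzzy_prod X m (\<lambda>_. u) z \<in> u ` X"
    using fuzzy_prod_mem[of z X m "\<lambda>_. u"] assms(2) tuplesD[of z X m] by auto
qed

lemma compact_tuples:
  fixes K :: "'a::metric_space set"
  assumes "compact K"
  shows "compact (tuples K m)"
proof -
  \<comment> \<open>Extensional tuples form a full product over all indices: each index from
    \<open>m\<close> on contributes the singleton of \<open>undefined\<close>, so every factor is
    compact and Tychonoff's theorem applies.\<close>
  have eq: "tuples K m = Pi\<^sub>E UNIV (\<lambda>i. if i < m then K else {undefined})"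
    by (fastforce simp: tuples_def PiE_def Pi_def extensional_def split: if_splits)
  have "compactin (product_topology (\<lambda>i. euclidean) UNIV)
          (Pi\<^sub>E UNIV (\<lambda>i. if i < m then K else {undefined}))"
    unfolding compactin_PiE using assms by auto
  then show ?thesis
    by (simp add: eq euclidean_product_topology)
qed

text \<open>A cut at a positive level is closed only relative to \<open>X\<close>, but it lies in
  the compact 0-cut and is therefore the intersection of that cut with a closed set.\<close>

lemma compact_alpha_cut:
  assumes "u \<in> fuzzy_star X" "0 \<le> c" "c \<le> 1"
  shows "compact (alpha_cut X u c)"
proof (cases "c = 0")
  case True
  then show ?thesis
    using fuzzy_starD(3)[OF assms(1)] by simp
next
  case False
  then have "closedin (top_of_set X) (alpha_cut X u c)"
    using fuzzy_starD(4)[OF assms(1)] assms(2,3) by simp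
  then obtain T where T: "closed T" "alpha_cut X u c = X \<inter> T"
    by (auto simp: closedin_closed)
  have "alpha_cut X u c \<subseteq> alpha_cut X u 0"
    using False assms(2) closure_subset[of "{x \<in> X. u x > 0}"] by (auto simp: alpha_cut_def)
  moreover have "alpha_cut X u 0 \<subseteq> X"
    by (auto simp: alpha_cut_def)
  ultimately have "alpha_cut X u c = alpha_cut X u 0 \<inter> T"
    using T(2) by auto
  then show ?thesis
    using fuzzy_starD(3)[OF assms(1)] T(1) by (simp add: compact_Int_closed)
qed

text \<open>Let \<open>s\<close> be the supremum over the fibre of \<open>y\<close>. For 0 < c < s
  the tuples in the fibre of grade at least \<open>c\<close> form a nonempty compact set
  \<open>F c\<close>, decreasing in \<open>c\<close>. A point common to all of them has grade at
  least \<open>s\<close>.\<close>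

lemma fuzzy_image_attained_compact:
  fixes X :: "'a::metric_space set" and f :: "(nat \<Rightarrow> 'a) \<Rightarrow> 'a"
  assumes u: "u \<in> fuzzy_star X" and f: "continuous_on (tuples X m) f" and m: "m > 0"
  shows "fuzzy_image_attained (tuples X m) X f (fuzzy_prod X m (\<lambda>_. u))"
  unfolding fuzzy_image_attained_def
proof (intro ballI impI)
  fix y
  let ?p = "fuzzy_prod X m (\<lambda>_. u)"
  define s where "s = fuzzy_image (tuples X m) X f ?p y"
  define F where "F c = {z \<in> tuples (alpha_cut X u c) m. f z = y}" for c
  assume y: "y \<in> X" and "fuzzy_image (tuples X m) X f ?p y > 0"
  then have s: "s > 0"
    by (simp add: s_def)
  note bounds = fuzzy_prod_bounds[OF _ m fuzzy_starD(1)[OF u]]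
  have "s \<le> 1"
    using fuzzy_image_bounds[of y X "tuples X m" ?p f] bounds y by (auto simp: s_def)
  \<comment> \<open>The definition of \<open>F c\<close> by cuts yields compactness, this form by
    grades yields monotonicity. The level must be positive because the 0-cut is a closure, not a
    superlevel set.\<close>
  have F_iff: "z \<in> F c \<longleftrightarrow> z \<in> tuples X m \<and> f z = y \<and> c \<le> ?p z" if "c > 0" for c z
    using that m le_fuzzy_prod_iff[of z X m c "\<lambda>_. u"]
    by (auto simp: F_def tuples_def alpha_cut_def PiE_def Pi_def)
  have cpt: "compact (F c)" if c: "0 < c" "c < s" for c
  proof -
    have "tuples (alpha_cut X u c) m \<subseteq> tuples X m"
      using c by (auto simp: tuples_def alpha_cut_def PiE_def Pi_def)
    then have "closedin (top_of_set (tuples (alpha_cut X u c) m)) (F c)"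
      unfolding F_def by (intro continuous_closedin_preimage_constant continuous_on_subset[OF f])
    moreover have "compact (tuples (alpha_cut X u c) m)"
      using c \<open>s \<le> 1\<close> by (intro compact_tuples compact_alpha_cut[OF u]) auto
    ultimately show ?thesis
      using closedin_compact by blast
  qed
  have fibre: "{x \<in> tuples X m. f x = y} \<noteq> {}" and
    s_Sup: "s = (SUP x\<in>{x \<in> tuples X m. f x = y}. ?p x)"
    using s y by (auto simp: s_def fuzzy_image_def split: if_splits)
  have ne: "F c \<noteq> {}" if c: "0 < c" "c < s" for c
  proof -
    have "\<exists>x\<in>{x \<in> tuples X m. f x = y}. c < ?p x"
      using c(2) fibre bounds(2) unfolding s_Sup
      by (subst (asm) less_cSUP_iff) (auto intro!: bdd_aboveI2[of _ _ 1])
    then show ?thesis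
      using F_iff[OF c(1)] by fastforce
  qed
  \<comment> \<open>The finite intersection property needs one fixed compact set; \<open>s/2\<close>
    is merely a level strictly between 0 and \<open>s\<close>. A finite subfamily is settled by its
    largest level.\<close>
  have "F (s/2) \<inter> (\<Inter>c\<in>{0<..<s}. F c) \<noteq> {}"
  proof (rule compact_imp_fip_image)
    show "compact (F (s/2))"
      using s by (intro cpt) auto
    show "closed (F c)" if "c \<in> {0<..<s}" for c
      using that by (intro compact_imp_closed cpt) auto
    fix C assume C: "finite C" "C \<subseteq> {0<..<s}"
    define c where "c = Max (insert (s/2) C)"
    have "c \<in> insert (s/2) C"
      unfolding c_def using C(1) by (intro Max_in) auto
    then have c: "0 < c" "c < s"
      using C(2) s by auto
    obtain z where z: "z \<in> F c"
      using ne[OF c] by auto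
    have "z \<in> F d" if "d \<in> insert (s/2) C" for d
    proof -
      have "0 < d"
        using that C(2) s by auto
      moreover have "d \<le> c"
        unfolding c_def using that C(1) by (intro Max_ge) auto
      ultimately show ?thesis
        using z F_iff[of d z] F_iff[OF c(1), of z] by auto
    qed
    then have "z \<in> F (s/2) \<inter> (\<Inter>c\<in>C. F c)"
      by auto
    then show "F (s/2) \<inter> (\<Inter>c\<in>C. F c) \<noteq> {}"
      by blast
  qed
  then obtain z where "z \<in> F (s/2) \<inter> (\<Inter>c\<in>{0<..<s}. F c)"
    by blast
  then have z: "z \<in> F (s/2)" "\<And>c. 0 < c \<Longrightarrow> c < s \<Longrightarrow> z \<in> F c"
    by simp_all
  have "s \<le> ?p z"
  proof (rule dense_le_bounded[OF s])
    fix c assume "0 < c" "c < s"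
    then show "c \<le> ?p z"
      using z(2) F_iff by blast
  qed
  then show "\<exists>z\<in>tuples X m. f z = y \<and> fuzzy_image (tuples X m) X f ?p y \<le> ?p z"
    using z(1) F_iff[of "s/2" z] s unfolding s_def[symmetric] by auto
qed

section \<open>Grades under the fuzzy operator: lower bounds from tuples, and tuples from positive
  grades\<close>

lemma Z_bar_ge:
  assumes "m > 0" "u \<in> fuzzy_sets X" "admissible L \<rho>" "j \<in> {1..L}"
    and z: "z \<in> tuples X m" "\<phi> j z \<in> X" and s: "0 \<le> s" "\<forall>i<m. s \<le> u (z i)"
  shows "\<rho> j s \<le> Z_bar X m L \<phi> \<rho> u (\<phi> j z)"
proof -
  note bounds = fuzzy_prod_bounds[OF _ assms(1,2)]
  let ?t = "fuzzy_image (tuples X m) X (\<phi> j) (fuzzy_prod X m (\<lambda>_. u)) (\<phi> j z)"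
  have "s \<le> fuzzy_prod X m (\<lambda>_. u) z"
    using le_fuzzy_prod_iff[OF z(1) assms(1), of s "\<lambda>_. u"] s(2) by simp
  also have "\<dots> \<le> ?t"
    using bounds z by (intro fuzzy_image_upper) auto
  finally have "s \<le> ?t" .
  moreover have "?t \<in> {0..1}"
    using bounds z(2) by (intro fuzzy_image_bounds) auto
  moreover have "mono_on {0..1} (\<rho> j)"
    using assms(3,4) by (auto simp: admissible_def grey_level_map_def)
  ultimately have "\<rho> j s \<le> \<rho> j ?t"
    using s(1) by (auto simp: mono_on_def)
  also have "\<dots> \<le> Z_bar X m L \<phi> \<rho> u (\<phi> j z)"
    unfolding Z_bar_def Z_op_def using z(2) assms(4) by (auto intro!: Max_ge)
  finally show ?thesis .
qed

lemma Z_bar_in_fuzzy_sets: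
  assumes "m > 0" "u \<in> fuzzy_sets X" "admissible L \<rho>"
  shows "Z_bar X m L \<phi> \<rho> u \<in> fuzzy_sets X"
proof -
  note bounds = fuzzy_prod_bounds[OF _ assms(1,2)]
  have L: "{1..L} \<noteq> {}"
    using assms(3) by (auto simp: admissible_def)
  have "Z_bar X m L \<phi> \<rho> u x \<in> {0..1}" if "x \<in> X" for x
  proof -
    let ?g = "\<lambda>j. \<rho> j (fuzzy_image (tuples X m) X (\<phi> j) (fuzzy_prod X m (\<lambda>_. u)) x)"
    have "Max (?g ` {1..L}) \<in> ?g ` {1..L}"
      using L by (intro Max_in) auto
    then obtain j where "j \<in> {1..L}" "Max (?g ` {1..L}) = ?g j"
      by (rule imageE)
    moreover have "?g j \<in> {0..1}" if "j \<in> {1..L}" for j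
      using fuzzy_image_bounds[of x X "tuples X m" "fuzzy_prod X m (\<lambda>_. u)" "\<phi> j"] bounds
        \<open>x \<in> X\<close> that assms(3) by (auto simp: admissible_def grey_level_map_def Pi_def)
    ultimately have "Max (?g ` {1..L}) \<in> {0..1}"
      by metis
    then show ?thesis
      using that by (simp add: Z_bar_def Z_op_def)
  qed
  then show ?thesis
    by (auto simp: fuzzy_sets_def Z_bar_def Z_op_def)
qed

text \<open>The maximum over \<open>j\<close> is attained because there are finitely many maps.
  Since \<open>\<rho> j 0 = 0\<close>, a positive grade forces a positive inner supremum, which is
  the case in which \<open>att\<close> supplies a tuple.\<close>

lemma Z_bar_attained:
  assumes "m > 0" "u \<in> fuzzy_sets X" "admissible L \<rho>"
    and att: "\<forall>j\<in>{1..L}. fuzzy_image_attained (tuples X m) X (\<phi> j) (fuzzy_prod X m (\<lambda>_. u))"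
    and x: "x \<in> X" "Z_bar X m L \<phi> \<rho> u x > 0"
  obtains j z s where "j \<in> {1..L}" "z \<in> tuples X m" "\<phi> j z = x" "0 < s" "s \<le> 1"
    "\<forall>i<m. s \<le> u (z i)" "Z_bar X m L \<phi> \<rho> u x = \<rho> j s"
proof -
  note bounds = fuzzy_prod_bounds[OF _ assms(1,2)]
  let ?t = "\<lambda>j. fuzzy_image (tuples X m) X (\<phi> j) (fuzzy_prod X m (\<lambda>_. u)) x"
  have "Max ((\<lambda>j. \<rho> j (?t j)) ` {1..L}) \<in> (\<lambda>j. \<rho> j (?t j)) ` {1..L}"
    using assms(3) by (intro Max_in) (auto simp: admissible_def)
  then obtain j where j: "j \<in> {1..L}" "Z_bar X m L \<phi> \<rho> u x = \<rho> j (?t j)"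
    using x(1) by (auto simp: Z_bar_def Z_op_def)
  have t: "?t j \<in> {0..1}"
    using bounds x(1) by (intro fuzzy_image_bounds) auto
  have "\<rho> j 0 = 0"
    using assms(3) j(1) by (auto simp: admissible_def grey_level_map_def)
  then have "?t j \<noteq> 0"
    using x(2) j(2) by auto
  then have pos: "?t j > 0"
    using t by simp
  then obtain z where z: "z \<in> tuples X m" "\<phi> j z = x" "?t j \<le> fuzzy_prod X m (\<lambda>_. u) z"
    using att j(1) x(1) unfolding fuzzy_image_attained_def by blast
  have "\<forall>i<m. ?t j \<le> u (z i)"
    using z(3) le_fuzzy_prod_iff[OF z(1) assms(1), of "?t j" "\<lambda>_. u"] by simp
  then show ?thesis
    using that j z(1,2) pos t by auto
qed

subsection \<open>Nearness of fuzzy sets\<close>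

text \<open>The relation is one-sided and allows two carriers, so that a fuzzy set on the net can be
  compared with one on the whole space without being extended first.\<close>

definition fuzzy_near ::
  "real \<Rightarrow> 'a::metric_space set \<Rightarrow> ('a \<Rightarrow> real) \<Rightarrow> 'a set \<Rightarrow> ('a \<Rightarrow> real) \<Rightarrow> bool" where
  "fuzzy_near D X u Y v \<longleftrightarrow> (\<forall>x\<in>X. u x > 0 \<longrightarrow> (\<exists>y\<in>Y. u x \<le> v y \<and> dist x y \<le> D))"

text \<open>A point of positive grade is lifted to a tuple, each entry is moved by at most
  \<open>D\<close> without losing grade, and the result is mapped by \<open>\<psi> j\<close>.
  Attainment enters only for the source \<open>u\<close>: on the target side any tuple already
  bounds the supremum from below.\<close>

lemma fuzzy_near_Z_bar:
  fixes X Y :: "'a::metric_space set"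
  assumes m: "m > 0" and adm: "admissible L \<rho>"
    and u: "u \<in> fuzzy_sets X" and v: "v \<in> fuzzy_sets Y"
    and att: "\<forall>j\<in>{1..L}. fuzzy_image_attained (tuples X m) X (\<phi> j) (fuzzy_prod X m (\<lambda>_. u))"
    and \<psi>: "\<forall>j\<in>{1..L}. \<psi> j \<in> tuples Y m \<rightarrow> Y"
    and a: "a \<ge> 0"
    and dist: "\<And>j x y. j \<in> {1..L} \<Longrightarrow> x \<in> tuples X m \<Longrightarrow> y \<in> tuples Y m \<Longrightarrow>
      dist (\<phi> j x) (\<psi> j y) \<le> e + a * max_dist m x y"
    and near: "fuzzy_near D X u Y v"
  shows "fuzzy_near (e + a * D) X (Z_bar X m L \<phi> \<rho> u) Y (Z_bar Y m L \<psi> \<rho> v)"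
  unfolding fuzzy_near_def
proof (intro ballI impI)
  fix x assume x: "x \<in> X" "Z_bar X m L \<phi> \<rho> u x > 0"
  obtain j z s where j: "j \<in> {1..L}" and z: "z \<in> tuples X m" "\<phi> j z = x"
    and s: "0 < s" "\<forall>i<m. s \<le> u (z i)" and eq: "Z_bar X m L \<phi> \<rho> u x = \<rho> j s"
    using Z_bar_attained[OF m u adm att x] by metis
  have "\<forall>i. \<exists>y. i < m \<longrightarrow> y \<in> Y \<and> u (z i) \<le> v y \<and> dist (z i) y \<le> D"
  proof
    fix i
    show "\<exists>y. i < m \<longrightarrow> y \<in> Y \<and> u (z i) \<le> v y \<and> dist (z i) y \<le> D"
    proof (cases "i < m")
      case True
      then have "u (z i) > 0" "z i \<in> X"
        using s tuplesD[OF z(1)] by force+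
      then show ?thesis
        using near unfolding fuzzy_near_def by blast
    qed simp
  qed
  then obtain g where g: "\<And>i. i < m \<Longrightarrow> g i \<in> Y \<and> u (z i) \<le> v (g i) \<and> dist (z i) (g i) \<le> D"
    by metis
  define y where "y = restrict g {..<m}"
  have y: "y \<in> tuples Y m"
    using g by (auto simp: y_def tuples_def)
  have "\<rho> j s \<le> Z_bar Y m L \<psi> \<rho> v (\<psi> j y)"
  proof (rule Z_bar_ge[OF m v adm j y])
    show "\<psi> j y \<in> Y"
      using \<psi> j y by auto
    show "\<forall>i<m. s \<le> v (y i)"
      using s(2) g by (force simp: y_def)
  qed (use s in simp)
  moreover have "max_dist m z y \<le> D"
    unfolding max_dist_def using g m by (subst Max_le_iff) (auto simp: y_def)
  then have "dist x (\<psi> j y) \<le> e + a * D"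
    using dist[OF j z(1) y] z(2) a mult_left_mono[of "max_dist m z y" D a] by auto
  ultimately show "\<exists>y\<in>Y. Z_bar X m L \<phi> \<rho> u x \<le> Z_bar Y m L \<psi> \<rho> v y \<and> dist x y \<le> e + a * D"
    using eq \<psi> j y by (intro bexI[of _ "\<psi> j y"]) auto
qed

text \<open>The points added by the extension have grade 0, and nearness quantifies only over points
  of positive grade. In the companion lemma for the right argument, the witness must have positive
  grade and so lies in the net.\<close>

lemma fuzzy_near_ext_left:
  assumes "Xh \<subseteq> X"
  shows "fuzzy_near D X (fuzzy_ext X Xh u) Y v \<longleftrightarrow> fuzzy_near D Xh u Y v"
  using assms by (auto simp: fuzzy_near_def fuzzy_ext_def subset_iff)

lemma fuzzy_near_ext_right:
  assumes "Xh \<subseteq> X"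
  shows "fuzzy_near D Y v X (fuzzy_ext X Xh u) \<longleftrightarrow> fuzzy_near D Y v Xh u"
proof
  assume L: "fuzzy_near D Y v X (fuzzy_ext X Xh u)"
  show "fuzzy_near D Y v Xh u"
    unfolding fuzzy_near_def
  proof (intro ballI impI)
    fix y assume y: "y \<in> Y" "0 < v y"
    then obtain x where x: "x \<in> X" "v y \<le> fuzzy_ext X Xh u x" "dist y x \<le> D"
      using L by (auto simp: fuzzy_near_def)
    then have "x \<in> Xh" "v y \<le> u x"
      using y(2) by (auto simp: fuzzy_ext_def split: if_splits)
    then show "\<exists>x\<in>Xh. v y \<le> u x \<and> dist y x \<le> D"
      using x(3) by blast
  qed
next
  assume R: "fuzzy_near D Y v Xh u"
  show "fuzzy_near D Y v X (fuzzy_ext X Xh u)"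
    unfolding fuzzy_near_def
  proof (intro ballI impI)
    fix y assume "y \<in> Y" "0 < v y"
    then obtain x where "x \<in> Xh" "v y \<le> u x" "dist y x \<le> D"
      using R by (auto simp: fuzzy_near_def)
    then show "\<exists>x\<in>X. v y \<le> fuzzy_ext X Xh u x \<and> dist y x \<le> D"
      using assms by (intro bexI[of _ x]) (auto simp: fuzzy_ext_def)
  qed
qed

section \<open>Nearness and the supremum metric\<close>

lemma alpha_cut_normal:
  assumes "x \<in> X" "u x = 1" "c \<le> 1"
  shows "x \<in> alpha_cut X u c"
  using assms closure_subset[of "{x \<in> X. u x > 0}"] by (auto simp: alpha_cut_def)

lemma infdist_alpha_cut_le:
  assumes near: "fuzzy_near D X u X v" and c: "0 \<le> c" and x: "x \<in> alpha_cut X u c"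
  shows "infdist x (alpha_cut X v c) \<le> D"
proof (cases "c = 0")
  case False
  then obtain y where "y \<in> X" "u x \<le> v y" "dist x y \<le> D"
    using near c x unfolding fuzzy_near_def alpha_cut_def by force
  then show ?thesis
    using False x by (intro infdist_le2[of y]) (auto simp: alpha_cut_def)
next
  case True
  let ?B = "alpha_cut X v 0"
  \<comment> \<open>At level 0 the bound is first proved on the points of positive grade. It passes
    to their closure because the points at distance at most \<open>D\<close> from \<open>?B\<close>
    form a closed set.\<close>
  have "{x \<in> X. u x > 0} \<subseteq> {x. infdist x ?B \<le> D}"
  proof safe
    fix x assume "x \<in> X" "0 < u x"
    then obtain y where y: "y \<in> X" "u x \<le> v y" "dist x y \<le> D"
      using near unfolding fuzzy_near_def by blast
    then have "y \<in> ?B"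
      using closure_subset[of "{x \<in> X. v x > 0}"] \<open>0 < u x\<close> by (auto simp: alpha_cut_def)
    then show "infdist x ?B \<le> D"
      using y(3) by (intro infdist_le2[of y])
  qed
  moreover have "closed {x. infdist x ?B \<le> D}"
    by (intro closed_Collect_le continuous_intros)
  ultimately have "closure {x \<in> X. u x > 0} \<subseteq> {x. infdist x ?B \<le> D}"
    by (rule closure_minimal)
  then show ?thesis
    using x True by (auto simp: alpha_cut_def)
qed

lemma d_infty_le:
  assumes u: "\<exists>x\<in>X. u x = 1" and v: "\<exists>x\<in>X. v x = 1"
    and uv: "fuzzy_near D X u X v" and vu: "fuzzy_near D X v X u"
  shows "d_infty X u v \<le> D"
  unfolding d_infty_def
proof (rule cSUP_least)
  fix c :: real assume c: "c \<in> {0..1}"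
  \<comment> \<open>Normality makes every cut nonempty, without which the real suprema in
    \<open>hausdorff_dist\<close> could not be bounded from their members.\<close>
  have "alpha_cut X u c \<noteq> {}" "alpha_cut X v c \<noteq> {}"
    using u v alpha_cut_normal[of _ X _ c] c by (metis atLeastAtMost_iff empty_iff)+
  then show "hausdorff_dist (alpha_cut X u c) (alpha_cut X v c) \<le> D"
    unfolding hausdorff_dist_def
    using infdist_alpha_cut_le[OF uv] infdist_alpha_cut_le[OF vu] c
    by (intro max.boundedI cSUP_least) auto
qed auto

lemma alpha_cut_subset_zero:
  "0 \<le> c \<Longrightarrow> alpha_cut X u c \<subseteq> alpha_cut X u 0"
  using closure_subset[of "{x \<in> X. u x > 0}"] by (auto simp: alpha_cut_def)

text \<open>A supremum of reals dominates its members only if they are bounded. All cuts lie in the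
  two compact 0-cuts, whose union has bounded diameter, and this one bound \<open>M\<close> serves
  both the Hausdorff distances and the supremum over levels.\<close>

lemma infdist_le_d_infty:
  assumes u: "u \<in> fuzzy_star X" and v: "v \<in> fuzzy_star X" and c: "c \<in> {0..1}"
  shows "a \<in> alpha_cut X u c \<Longrightarrow> infdist a (alpha_cut X v c) \<le> d_infty X u v"
    and "b \<in> alpha_cut X v c \<Longrightarrow> infdist b (alpha_cut X u c) \<le> d_infty X u v"
proof -
  have "bounded (alpha_cut X u 0 \<union> alpha_cut X v 0)"
    using fuzzy_starD(3)[OF u] fuzzy_starD(3)[OF v] by (simp add: compact_imp_bounded)
  then obtain M where M: "\<And>x y. x \<in> alpha_cut X u 0 \<union> alpha_cut X v 0 \<Longrightarrow>
      y \<in> alpha_cut X u 0 \<union> alpha_cut X v 0 \<Longrightarrow> dist x y \<le> M"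
    by (metis bounded_two_points)
  have bound: "infdist a (alpha_cut X w' t) \<le> M"
    if "t \<in> {0..1}" "a \<in> alpha_cut X w t" "w \<in> {u, v}" "w' \<in> {u, v}" for a w w' t
  proof -
    obtain b where "b \<in> X" "w' b = 1"
      using fuzzy_starD(2) u v \<open>w' \<in> {u, v}\<close> by blast
    then have b: "b \<in> alpha_cut X w' t"
      using that(1) by (intro alpha_cut_normal) auto
    then have "dist a b \<le> M"
      using that alpha_cut_subset_zero[of t X w] alpha_cut_subset_zero[of t X w']
      by (intro M) auto
    then show ?thesis
      using b infdist_le2 by blast
  qed
  let ?h = "\<lambda>t. hausdorff_dist (alpha_cut X u t) (alpha_cut X v t)"
  have ne: "alpha_cut X w t \<noteq> {}" if "t \<in> {0..1}" "w \<in> {u, v}" for t w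
    using fuzzy_starD(2)[OF u] fuzzy_starD(2)[OF v] alpha_cut_normal[of _ X w t] that by force
  have "?h t \<le> M" if "t \<in> {0..1}" for t
    unfolding hausdorff_dist_def using that ne bound[OF that]
    by (intro max.boundedI cSUP_least) auto
  then have "bdd_above (?h ` {0..1})"
    by (intro bdd_aboveI2)
  then have h: "?h c \<le> d_infty X u v"
    unfolding d_infty_def using c by (intro cSUP_upper)
  show "infdist a (alpha_cut X v c) \<le> d_infty X u v" if "a \<in> alpha_cut X u c"
  proof -
    have "infdist a (alpha_cut X v c) \<le> (SUP a\<in>alpha_cut X u c. infdist a (alpha_cut X v c))"
      using that bound[OF c] by (intro cSUP_upper bdd_aboveI2[of _ _ M]) auto
    then show ?thesis
      using h by (simp add: hausdorff_dist_def)
  qed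
  show "infdist b (alpha_cut X u c) \<le> d_infty X u v" if "b \<in> alpha_cut X v c"
  proof -
    have "infdist b (alpha_cut X u c) \<le> (SUP b\<in>alpha_cut X v c. infdist b (alpha_cut X u c))"
      using that bound[OF c] by (intro cSUP_upper bdd_aboveI2[of _ _ M]) auto
    then show ?thesis
      using h by (simp add: hausdorff_dist_def)
  qed
qed

lemma infdist_attained_compact:
  fixes B :: "'a::metric_space set"
  assumes "compact B" "B \<noteq> {}"
  shows "\<exists>b\<in>B. dist a b = infdist a B"
proof -
  have "continuous_on B (dist a)"
    by (intro continuous_intros)
  then obtain b where b: "b \<in> B" "\<And>y. y \<in> B \<Longrightarrow> dist a b \<le> dist a y"
    using continuous_attains_inf[OF assms] by metis
  have "dist a b \<le> infdist a B"
    using assms(2) b by (auto simp: infdist_notempty intro!: cINF_greatest)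
  then show ?thesis
    using b(1) infdist_le[OF b(1), of a] by force
qed

text \<open>A point \<open>x\<close> is tested at its own level \<open>u x\<close>. Compactness of
  the corresponding cut of \<open>v\<close> provides a nearest point, whose grade is at least
  \<open>u x\<close> because the level is positive.\<close>

lemma fuzzy_near_of_infdist:
  assumes u: "u \<in> fuzzy_sets X" and v: "v \<in> fuzzy_star X"
    and le: "\<And>c a. c \<in> {0..1} \<Longrightarrow> a \<in> alpha_cut X u c \<Longrightarrow> infdist a (alpha_cut X v c) \<le> D"
  shows "fuzzy_near D X u X v"
  unfolding fuzzy_near_def
proof (intro ballI impI)
  fix x assume x: "x \<in> X" "u x > 0"
  then have ux: "u x \<in> {0..1}" "x \<in> alpha_cut X u (u x)"
    using fuzzy_setsD[OF u] by (auto simp: alpha_cut_def)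
  have "alpha_cut X v (u x) \<noteq> {}"
    using fuzzy_starD(2)[OF v] alpha_cut_normal[of _ X v "u x"] ux(1) by force
  then obtain y where "y \<in> alpha_cut X v (u x)" "dist x y = infdist x (alpha_cut X v (u x))"
    using infdist_attained_compact[OF compact_alpha_cut[OF v]] ux(1) by (metis atLeastAtMost_iff)
  then show "\<exists>y\<in>X. u x \<le> v y \<and> dist x y \<le> D"
    using le[OF ux] x(2) by (intro bexI[of _ y]) (auto simp: alpha_cut_def)
qed

lemma fuzzy_near_d_infty:
  assumes "u \<in> fuzzy_star X" "v \<in> fuzzy_star X"
  shows "fuzzy_near (d_infty X u v) X u X v" "fuzzy_near (d_infty X u v) X v X u"
  using infdist_le_d_infty[OF assms] fuzzy_starD(1) assms
  by (auto intro!: fuzzy_near_of_infdist)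

subsection \<open>Finitely supported fuzzy sets\<close>

text \<open>On a proper net this is exactly \<open>fuzzy_star\<close>, by
  \<open>finite_fuzzy_subset_fuzzy_star\<close> and \<open>fuzzy_star_proper_net\<close>; this form
  makes invariance under the operator a matter of counting.\<close>

definition finite_fuzzy :: "'a set \<Rightarrow> ('a \<Rightarrow> real) set" where
  "finite_fuzzy X = {u \<in> fuzzy_sets X. (\<exists>x\<in>X. u x = 1) \<and> finite {x \<in> X. u x > 0}}"

lemma finite_fuzzy_subset_fuzzy_star:
  fixes X :: "'a::metric_space set"
  shows "finite_fuzzy X \<subseteq> fuzzy_star X"
proof
  fix u assume u: "u \<in> finite_fuzzy X"
  then have fin: "finite {x \<in> X. u x > 0}"
    by (simp add: finite_fuzzy_def)
  have "alpha_cut X u 0 = {x \<in> X. u x > 0}"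
    using finite_imp_closed[OF fin] by (auto simp: alpha_cut_def)
  then have "compact (alpha_cut X u 0)"
    using fin by (simp add: finite_imp_compact)
  moreover have "closedin (top_of_set X) (alpha_cut X u c)" if "c \<in> {0<..1}" for c
  proof (rule closed_subset)
    show "alpha_cut X u c \<subseteq> X"
      by (auto simp: alpha_cut_def)
    have "alpha_cut X u c \<subseteq> {x \<in> X. u x > 0}"
      using that by (auto simp: alpha_cut_def)
    then show "closed (alpha_cut X u c)"
      using fin finite_subset finite_imp_closed by blast
  qed
  ultimately show "u \<in> fuzzy_star X"
    using u by (auto simp: fuzzy_star_def finite_fuzzy_def)
qed

lemma finite_fuzzy_ext:
  assumes "u \<in> finite_fuzzy Xh" "Xh \<subseteq> X"
  shows "fuzzy_ext X Xh u \<in> finite_fuzzy X"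
proof -
  have "{x \<in> X. fuzzy_ext X Xh u x > 0} = {x \<in> Xh. u x > 0}"
    using assms(2) by (auto simp: fuzzy_ext_def split: if_splits)
  moreover obtain x where "x \<in> Xh" "u x = 1"
    using assms(1) by (auto simp: finite_fuzzy_def)
  then have "\<exists>x\<in>X. fuzzy_ext X Xh u x = 1"
    using assms(2) by (intro bexI[of _ x]) (auto simp: fuzzy_ext_def)
  moreover have "fuzzy_ext X Xh u \<in> fuzzy_sets X"
    using assms(1) fuzzy_setsD[of u Xh] by (auto simp: finite_fuzzy_def fuzzy_sets_def fuzzy_ext_def)
  ultimately show ?thesis
    using assms(1) by (auto simp: finite_fuzzy_def)
qed

lemma finite_fuzzy_attained:
  assumes "u \<in> finite_fuzzy X" "m > 0"
  shows "fuzzy_image_attained (tuples X m) X f (fuzzy_prod X m (\<lambda>_. u))"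
proof -
  have "u ` X \<subseteq> insert 0 (u ` {x \<in> X. u x > 0})"
    using assms(1) fuzzy_setsD[of u X] by (fastforce simp: finite_fuzzy_def)
  moreover have "finite (insert 0 (u ` {x \<in> X. u x > 0}))"
    using assms(1) by (simp add: finite_fuzzy_def)
  ultimately have "finite (u ` X)"
    by (rule finite_subset)
  then show ?thesis
    using assms(2) by (intro fuzzy_image_attained_finite finite_fuzzy_prod_range)
qed

lemma Z_bar_finite_fuzzy:
  assumes m: "m > 0" and adm: "admissible L \<rho>" and u: "u \<in> finite_fuzzy X"
    and \<phi>: "\<forall>j\<in>{1..L}. \<phi> j \<in> tuples X m \<rightarrow> X"
  shows "Z_bar X m L \<phi> \<rho> u \<in> finite_fuzzy X"
proof -
  have us: "u \<in> fuzzy_sets X" and fin: "finite {x \<in> X. u x > 0}"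
    using u by (auto simp: finite_fuzzy_def)
  note Z = Z_bar_in_fuzzy_sets[OF m us adm, of \<phi>]
  let ?S = "{x \<in> X. u x > 0}"
  \<comment> \<open>A point of positive grade lifts to a tuple whose entries all have positive
    grade, and there are only finitely many such tuples.\<close>
  have "{x \<in> X. Z_bar X m L \<phi> \<rho> u x > 0} \<subseteq> (\<Union>j\<in>{1..L}. \<phi> j ` tuples ?S m)"
  proof safe
    fix x assume x: "x \<in> X" "Z_bar X m L \<phi> \<rho> u x > 0"
    obtain j z s where j: "j \<in> {1..L}" and z: "z \<in> tuples X m" "\<phi> j z = x"
      and s: "0 < s" "\<forall>i<m. s \<le> u (z i)"
      using Z_bar_attained[OF m us adm _ x] finite_fuzzy_attained[OF u m] by metis
    have "z \<in> tuples ?S m"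
      using z(1) s by (force simp: tuples_def PiE_def Pi_def)
    then show "x \<in> (\<Union>j\<in>{1..L}. \<phi> j ` tuples ?S m)"
      using j z(2) by blast
  qed
  moreover have "finite (\<Union>j\<in>{1..L}. \<phi> j ` tuples ?S m)"
    using fin by (auto simp: tuples_def intro!: finite_PiE)
  ultimately have "finite {x \<in> X. Z_bar X m L \<phi> \<rho> u x > 0}"
    by (rule finite_subset)
  moreover have "\<exists>x\<in>X. Z_bar X m L \<phi> \<rho> u x = 1"
  proof -
    obtain x where x: "x \<in> X" "u x = 1"
      using u by (auto simp: finite_fuzzy_def)
    obtain j where j: "j \<in> {1..L}" "\<rho> j 1 = 1"
      using adm by (auto simp: admissible_def)
    \<comment> \<open>Normality is inherited through the constant tuple at a point of grade 1 and an
      index with \<open>\<rho> j 1 = 1\<close>.\<close>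
    define z where "z = restrict (\<lambda>_. x) {..<m}"
    have z: "z \<in> tuples X m"
      using x by (auto simp: z_def tuples_def)
    then have zX: "\<phi> j z \<in> X"
      using \<phi> j(1) by auto
    have "\<rho> j 1 \<le> Z_bar X m L \<phi> \<rho> u (\<phi> j z)"
      using x by (intro Z_bar_ge[where \<phi> = \<phi> and z = z, OF m us adm j(1) z zX]) (auto simp: z_def)
    then show ?thesis
      using j(2) fuzzy_setsD(2)[OF Z zX] zX by (intro bexI[of _ "\<phi> j z"]) auto
  qed
  ultimately show ?thesis
    using Z by (simp add: finite_fuzzy_def)
qed

text \<open>The compact 0-cut is bounded, so properness leaves only finitely many net points in
  it.\<close>

lemma fuzzy_star_proper_net:
  fixes X :: "'a::metric_space set"
  assumes "u \<in> fuzzy_star Xh" "proper_eps_net X e Xh"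
  shows "u \<in> finite_fuzzy Xh"
proof -
  let ?A = "alpha_cut Xh u 0"
  have sub: "?A \<subseteq> Xh" "Xh \<subseteq> X"
    using assms(2) by (auto simp: alpha_cut_def proper_eps_net_def eps_net_def)
  have "bounded ?A"
    using fuzzy_starD(3)[OF assms(1)] compact_imp_bounded by blast
  then have "finite (?A \<inter> Xh)"
    using assms(2) sub unfolding proper_eps_net_def by blast
  moreover have "{x \<in> Xh. u x > 0} \<subseteq> ?A \<inter> Xh"
    using closure_subset[of "{x \<in> Xh. u x > 0}"] by (auto simp: alpha_cut_def)
  ultimately show ?thesis
    using fuzzy_starD(1,2)[OF assms(1)] finite_subset[of _ "?A \<inter> Xh"] by (simp add: finite_fuzzy_def)
qed

subsection \<open>Lipschitz constants\<close>

lemma max_dist_commute: "max_dist m x y = max_dist m y x"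
  by (simp add: max_dist_def dist_commute)

lemma max_dist_nonneg: "m > 0 \<Longrightarrow> max_dist m x y \<ge> 0"
  unfolding max_dist_def by (subst Max_ge_iff) auto

text \<open>The infimum defining \<open>Lip\<close> is itself a Lipschitz constant: each quotient of
  distances is a lower bound of all Lipschitz constants.\<close>

lemma
  assumes "lip_bound X m f c" "m > 0"
  shows Lip_nonneg: "Lip X m f \<ge> 0"
    and dist_le_Lip: "x \<in> tuples X m \<Longrightarrow> y \<in> tuples X m \<Longrightarrow>
      dist (f x) (f y) \<le> Lip X m f * max_dist m x y"
proof -
  have ne: "{c. lip_bound X m f c} \<noteq> {}"
    using assms(1) by auto
  show nn: "Lip X m f \<ge> 0"
    unfolding Lip_def using ne by (intro cInf_greatest) (auto simp: lip_bound_def)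
  assume xy: "x \<in> tuples X m" "y \<in> tuples X m"
  show "dist (f x) (f y) \<le> Lip X m f * max_dist m x y"
  proof (cases "max_dist m x y = 0")
    \<comment> \<open>No quotient can be formed here; any Lipschitz constant already forces the
      image distance to be 0.\<close>
    case True
    then show ?thesis
      using assms(1) xy unfolding lip_bound_def by (metis mult_zero_right)
  next
    case False
    then have pos: "max_dist m x y > 0"
      using max_dist_nonneg[OF assms(2), of x y] by simp
    have "dist (f x) (f y) / max_dist m x y \<le> Lip X m f"
      unfolding Lip_def using ne xy pos
      by (intro cInf_greatest) (auto simp: lip_bound_def divide_simps)
    then show ?thesis
      using pos by (simp add: divide_simps)
  qed
qed

lemma
  assumes "\<forall>j\<in>{1..L}. gen_banach_contraction X m (\<phi> j)" "L \<ge> 1" "m > 0"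
  shows alpha_S_nonneg: "alpha_S X m L \<phi> \<ge> 0"
    and alpha_S_less_1: "alpha_S X m L \<phi> < 1"
    and dist_le_alpha_S: "j \<in> {1..L} \<Longrightarrow> x \<in> tuples X m \<Longrightarrow> y \<in> tuples X m \<Longrightarrow>
      dist (\<phi> j x) (\<phi> j y) \<le> alpha_S X m L \<phi> * max_dist m x y"
proof -
  have Lip: "0 \<le> Lip X m (\<phi> j)" "Lip X m (\<phi> j) < 1" "Lip X m (\<phi> j) \<le> alpha_S X m L \<phi>"
    if "j \<in> {1..L}" for j
  proof -
    obtain c where "lip_bound X m (\<phi> j) c"
      using assms(1) \<open>j \<in> {1..L}\<close> unfolding gen_banach_contraction_def by blast
    then show "0 \<le> Lip X m (\<phi> j)"
      using Lip_nonneg assms(3) by blast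
    show "Lip X m (\<phi> j) < 1" "Lip X m (\<phi> j) \<le> alpha_S X m L \<phi>"
      using assms(1) that by (auto simp: gen_banach_contraction_def alpha_S_def)
  qed
  show "alpha_S X m L \<phi> \<ge> 0"
    using Lip[of 1] assms(2) by auto
  show "alpha_S X m L \<phi> < 1"
    unfolding alpha_S_def using Lip(2) assms(2) by (subst Max_less_iff) auto
  assume j: "j \<in> {1..L}" and xy: "x \<in> tuples X m" "y \<in> tuples X m"
  obtain c where "lip_bound X m (\<phi> j) c"
    using assms(1) j unfolding gen_banach_contraction_def by blast
  then have "dist (\<phi> j x) (\<phi> j y) \<le> Lip X m (\<phi> j) * max_dist m x y"
    using dist_le_Lip assms(3) xy by blast
  also have "\<dots> \<le> alpha_S X m L \<phi> * max_dist m x y"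
    using Lip(3)[OF j] max_dist_nonneg[OF assms(3)] by (rule mult_right_mono)
  finally show "dist (\<phi> j x) (\<phi> j y) \<le> alpha_S X m L \<phi> * max_dist m x y" .
qed

theorem theorem10p4:
  fixes X Xh :: "'a::metric_space set" and m L :: nat
    and \<phi> :: "nat \<Rightarrow> (nat \<Rightarrow> 'a) \<Rightarrow> 'a" and \<rho> :: "nat \<Rightarrow> real \<Rightarrow> real"
    and uS u :: "'a \<Rightarrow> real" and \<epsilon> :: real and r :: "'a \<Rightarrow> 'a"
  assumes "complete X"
    and "m \<ge> 2"
    and "gifzs X m L \<phi> \<rho>"
    and "\<forall>j\<in>{1..L}. gen_banach_contraction X m (\<phi> j)"
    and "fuzzy_attractor X m L \<phi> \<rho> uS"
    and "\<epsilon> > 0"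
    and "proper_eps_net X \<epsilon> Xh"
    and "eps_projection X \<epsilon> Xh r"
    and "u \<in> fuzzy_star Xh"
  shows "(\<forall>n. d_infty X (fuzzy_ext X Xh ((Z_bar Xh m L (discretization Xh m r \<phi>) \<rho> ^^ n) u)) uS
              \<le> 5 * \<epsilon> / (1 - alpha_S X m L \<phi>)
                + alpha_S X m L \<phi> ^ n * d_infty X (fuzzy_ext X Xh u) uS) \<and>
         (\<exists>n0. \<forall>n\<ge>n0. attractor_with_resolution X m L \<phi> \<rho> (6 * \<epsilon> / (1 - alpha_S X m L \<phi>))
              (fuzzy_ext X Xh ((Z_bar Xh m L (discretization Xh m r \<phi>) \<rho> ^^ n) u)))"
proof -
  define a where "a = alpha_S X m L \<phi>"
  define \<psi> where "\<psi> = discretization Xh m r \<phi>"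
  define w where "w n = (Z_bar Xh m L \<psi> \<rho> ^^ n) u" for n
  define D0 where "D0 = d_infty X (fuzzy_ext X Xh u) uS"
  \<comment> \<open>This solves the recursion \<open>D (Suc n) = \<epsilon> + a * D n\<close>, whose
    fixed point is \<open>\<epsilon> / (1 - a)\<close>; the initial value is at least
    \<open>D0\<close>.\<close>
  define D where "D n = \<epsilon> / (1 - a) + a ^ n * D0" for n
  have m: "m > 0"
    using assms(2) by simp
  have adm: "admissible L \<rho>"
    using assms(3) by (simp add: gifzs_def)
  then have L: "L \<ge> 1"
    by (auto simp: admissible_def)
  have sub: "Xh \<subseteq> X"
    using assms(7) by (auto simp: proper_eps_net_def eps_net_def)
  have \<phi>: "\<forall>j\<in>{1..L}. \<phi> j \<in> tuples X m \<rightarrow> X"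
    using assms(3) by (simp add: gifzs_def)
  have tsub: "tuples Xh m \<subseteq> tuples X m"
    using sub unfolding tuples_def by (rule PiE_mono)
  have \<psi>: "\<forall>j\<in>{1..L}. \<psi> j \<in> tuples Xh m \<rightarrow> Xh"
    using \<phi> tsub assms(8) by (fastforce simp: \<psi>_def discretization_def eps_projection_def Pi_def)
  note a0 = alpha_S_nonneg[OF assms(4) L m, folded a_def]
  note a1 = alpha_S_less_1[OF assms(4) L m, folded a_def]
  have uS: "uS \<in> fuzzy_star X" "Z_bar X m L \<phi> \<rho> uS = uS"
    using assms(5) by (auto simp: fuzzy_attractor_def Z_bar_def)
  have dist: "dist (\<phi> j x) (\<psi> j y) \<le> \<epsilon> + a * max_dist m x y"
    if "j \<in> {1..L}" "x \<in> tuples X m" "y \<in> tuples Xh m" for j x y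
  proof -
    have y: "y \<in> tuples X m"
      using that(3) tsub by blast
    then have \<phi>y: "\<phi> j y \<in> X"
      using \<phi> that(1) by blast
    have "dist (\<phi> j x) (\<psi> j y) \<le> dist (\<phi> j x) (\<phi> j y) + dist (\<phi> j y) (\<psi> j y)"
      by (rule dist_triangle)
    moreover have "dist (\<phi> j y) (\<psi> j y) \<le> \<epsilon>"
      using assms(8) \<phi>y that(3) by (simp add: \<psi>_def discretization_def eps_projection_def)
    ultimately show ?thesis
      using dist_le_alpha_S[OF assms(4) L m that(1,2) y] by (simp add: a_def)
  qed
  have dist': "dist (\<psi> j y) (\<phi> j x) \<le> \<epsilon> + a * max_dist m y x"
    if "j \<in> {1..L}" "y \<in> tuples Xh m" "x \<in> tuples X m" for j x y
    using dist[OF that(1,3,2)] by (simp add: dist_commute max_dist_commute)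
  have w: "w n \<in> finite_fuzzy Xh" for n
  proof (induction n)
    case 0
    then show ?case
      using fuzzy_star_proper_net[OF assms(9,7)] by (simp add: w_def)
  next
    case (Suc n)
    then show ?case
      using Z_bar_finite_fuzzy[OF m adm _ \<psi>] by (simp add: w_def)
  qed
  then have ws: "w n \<in> fuzzy_sets Xh" for n
    by (simp add: finite_fuzzy_def)
  have ext: "fuzzy_ext X Xh (w n) \<in> fuzzy_star X" for n
    using finite_fuzzy_ext[OF w sub] finite_fuzzy_subset_fuzzy_star by blast
  have attS: "\<forall>j\<in>{1..L}. fuzzy_image_attained (tuples X m) X (\<phi> j) (fuzzy_prod X m (\<lambda>_. uS))"
    using assms(3) uS(1) m by (auto simp: gifzs_def intro!: fuzzy_image_attained_compact)
  have attw: "\<forall>j\<in>{1..L}. fuzzy_image_attained (tuples Xh m) Xh (\<psi> j) (fuzzy_prod Xh m (\<lambda>_. w n))"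
    for n
    using finite_fuzzy_attained[OF w m] by simp
  \<comment> \<open>Both directions are propagated together. The attractor is fixed by its operator,
    so applying the two operators advances only the discretized orbit.\<close>
  have near: "fuzzy_near (D n) Xh (w n) X uS \<and> fuzzy_near (D n) X uS Xh (w n)" for n
  proof (induction n)
    case 0
    have "D 0 \<ge> D0"
      using assms(6) a1 by (simp add: D_def)
    moreover have "fuzzy_near D0 Xh (w 0) X uS" "fuzzy_near D0 X uS Xh (w 0)"
      using fuzzy_near_d_infty[OF ext[of 0] uS(1)]
      by (simp_all add: fuzzy_near_ext_left[OF sub] fuzzy_near_ext_right[OF sub] D0_def w_def)
    ultimately show ?case
      unfolding fuzzy_near_def by (meson order_trans)
  next
    case (Suc n)
    have "\<epsilon> + a * D n = D (Suc n)"
      using a1 by (simp add: D_def field_simps)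
    moreover have "Z_bar Xh m L \<psi> \<rho> (w n) = w (Suc n)"
      by (simp add: w_def)
    ultimately show ?case
      using fuzzy_near_Z_bar[OF m adm ws fuzzy_starD(1)[OF uS(1)] attw \<phi> a0 dist', of "D n" n]
        fuzzy_near_Z_bar[OF m adm fuzzy_starD(1)[OF uS(1)] ws attS \<psi> a0 dist, of "D n" n] Suc
      by (simp add: uS(2))
  qed
  have le: "d_infty X (fuzzy_ext X Xh (w n)) uS \<le> D n" for n
    using near[of n] fuzzy_starD(2)[OF ext[of n]] fuzzy_starD(2)[OF uS(1)]
    by (intro d_infty_le) (simp_all add: fuzzy_near_ext_left[OF sub] fuzzy_near_ext_right[OF sub])
  have pos: "\<epsilon> / (1 - a) > 0"
    using assms(6) a1 by simp
  \<comment> \<open>Once the decaying term is below \<open>\<epsilon> / (1 - a)\<close>, the bound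
    \<open>D n\<close> is below twice that value, hence within the required resolution.\<close>
  have "(\<lambda>n. a ^ n * D0) \<longlonglongrightarrow> 0 * D0"
    using a0 a1 by (intro tendsto_mult LIMSEQ_realpow_zero tendsto_const)
  then have "\<forall>\<^sub>F n in sequentially. a ^ n * D0 < \<epsilon> / (1 - a)"
    using pos by (intro order_tendstoD(2)[where y = "0 * D0"]) auto
  then obtain n0 where n0: "\<And>n. n \<ge> n0 \<Longrightarrow> a ^ n * D0 < \<epsilon> / (1 - a)"
    by (auto simp: eventually_sequentially)
  have "d_infty X (fuzzy_ext X Xh (w n)) uS \<le> 5 * \<epsilon> / (1 - a) + a ^ n * D0" for n
    using le[of n] pos by (simp add: D_def)
  moreover have "attractor_with_resolution X m L \<phi> \<rho> (6 * \<epsilon> / (1 - a)) (fuzzy_ext X Xh (w n))"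
    if "n \<ge> n0" for n
  proof -
    have "d_infty X (fuzzy_ext X Xh (w n)) uS \<le> 6 * \<epsilon> / (1 - a)"
      using le[of n] n0[OF that] pos by (simp add: D_def)
    then show ?thesis
      using ext assms(5) by (auto simp: attractor_with_resolution_def)
  qed
  ultimately show ?thesis
    unfolding a_def \<psi>_def w_def D0_def by blast
qed

end
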